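(* Let $n\geq 4$ and let $G$ be a pineapple graph on $n$ vertices, i.e. $G$ is isomorphic to $U_{n,g}^p$ for some $3\leq g<n$. Then $$n^2+1+\binom{n-2}{2}\leq F(G)\leq 7\cdot 2^{n-3}+n,$$ with equality on the right if and only if $G$ is isomorphic to $U_{n,3}^p$, and equality on the left if and only if $G$ is isomorphic to $U_{n,n-1}^p$.
   Context: All graphs are finite, simple and undirected. The pineapple graph $U_{n,g}^p$ ($3\leq g<n$) is obtained from the cycle $C_g$ by attaching $n-g$ new pendant vertices to a single vertex of the cycle. A connected subgraph of a graph $G=(V,E)$ is a graph $(V',E')$ with $\emptyset\neq V'\subseteq V$, $E'\subseteq E$, every edge of $E'$ having both endpoints in $V'$, and $(V',E')$ connected; distinct pairs $(V',E')$ are counted separately. The core index $F(G)$ is the number of connected subgraphs of $G$. *)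

theory Defs
  imports Complex_Main
begin

text \<open>A graph is a pair of a vertex set and a set of edges, each edge being a two-element
  set of vertices.\<close>

type_synonym 'a graph = "'a set \<times> 'a set set"

abbreviation verts :: "'a graph \<Rightarrow> 'a set" where
  "verts G \<equiv> fst G"

abbreviation edges :: "'a graph \<Rightarrow> 'a set set" where
  "edges G \<equiv> snd G"

definition finite_simple_graph :: "'a graph \<Rightarrow> bool" where
  "finite_simple_graph G \<longleftrightarrow> finite (verts G) \<and> (\<forall>e\<in>edges G. e \<subseteq> verts G \<and> card e = 2)"

definition adj_rel :: "'a graph \<Rightarrow> 'a rel" where
  "adj_rel G = {(u, v). {u, v} \<in> edges G}"

definition connected_graph :: "'a graph \<Rightarrow> bool" where
  "connected_graph G \<longleftrightarrow>
     verts G \<noteq> {} \<and> (\<forall>u\<in>verts G. \<forall>v\<in>verts G. (u, v) \<in> (adj_rel G)\<^sup>*)"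

definition connected_subgraphs :: "'a graph \<Rightarrow> 'a graph set" where
  "connected_subgraphs G =
     {H. verts H \<noteq> {} \<and> verts H \<subseteq> verts G \<and> edges H \<subseteq> edges G \<and>
         (\<forall>e\<in>edges H. e \<subseteq> verts H) \<and> connected_graph H}"

definition core_index :: "'a graph \<Rightarrow> nat" where
  "core_index G = card (connected_subgraphs G)"

definition graph_iso :: "'a graph \<Rightarrow> 'b graph \<Rightarrow> bool" where
  "graph_iso G H \<longleftrightarrow>
     (\<exists>f. bij_betw f (verts G) (verts H) \<and>
          (\<forall>u\<in>verts G. \<forall>v\<in>verts G. {u, v} \<in> edges G \<longleftrightarrow> {f u, f v} \<in> edges H))"

definition cycle_graph :: "nat \<Rightarrow> nat graph" where
  "cycle_graph g = ({0..<g}, {{i, (i + 1) mod g} | i. i < g})"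

text \<open>The pendant vertices are \<open>g, \<dots>, n - 1\<close>, all attached to the vertex \<open>0\<close> of the cycle.
  Only parameters with \<open>3 \<le> g < n\<close> are meaningful.\<close>

definition pineapple :: "nat \<Rightarrow> nat \<Rightarrow> nat graph" where
  "pineapple n g =
     (verts (cycle_graph g) \<union> {g..<n}, edges (cycle_graph g) \<union> {{0, j} | j. j \<in> {g..<n}})"

lemma finite_simple_graph_pineapple:
  assumes "3 \<le> g" "g < n"
  shows "finite_simple_graph (pineapple n g)" and "card (verts (pineapple n g)) = n"
proof -
  have ne: "i \<noteq> Suc i mod g" if "i < g" for i
    using that assms by (cases "Suc i = g") auto
  show "finite_simple_graph (pineapple n g)"
    using assms ne
    by (fastforce simp: finite_simple_graph_def pineapple_def cycle_graph_def card_insert_if)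
  have "verts (pineapple n g) = {0..<n}"
    using assms by (auto simp: pineapple_def cycle_graph_def)
  then show "card (verts (pineapple n g)) = n"
    by simp
qed

end

theory Submission
  imports Defs
begin

text \<open>Hanging a pendant vertex on \<open>x\<close> doubles the number \<open>F\<^sub>x\<close> of connected subgraphs through \<open>x\<close>
  and adds \<open>F\<^sub>x + 1\<close> to the core index. The cycle \<open>C\<^sub>g\<close> has \<open>g\<^sup>2 + 1\<close> connected subgraphs,
  of which \<open>g(g+1)/2 + 1\<close> contain a given vertex, so
  \<open>F(U\<^sub>n\<^sub>,\<^sub>g) = 2\<^bsup>n-g\<^esup>(g(g+1)/2 + 1) + g(g-1)/2 + (n-g)\<close>.
  This is strictly decreasing in \<open>g\<close>, which yields both bounds and their equality cases.\<close>

section \<open>Connected subgraphs\<close>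

lemma adj_rel_iff: "(u, v) \<in> adj_rel G \<longleftrightarrow> {u, v} \<in> edges G"
  by (simp add: adj_rel_def)

lemma rtrancl_adj_rel_sym: "(u, v) \<in> (adj_rel G)\<^sup>* \<Longrightarrow> (v, u) \<in> (adj_rel G)\<^sup>*"
proof -
  have "sym (adj_rel G)"
    by (rule symI) (simp add: adj_rel_iff insert_commute)
  then show "(u, v) \<in> (adj_rel G)\<^sup>* \<Longrightarrow> (v, u) \<in> (adj_rel G)\<^sup>*"
    by (meson sym_rtrancl symD)
qed

lemma connected_graph_rootI:
  assumes "r \<in> verts G" "\<And>v. v \<in> verts G \<Longrightarrow> (r, v) \<in> (adj_rel G)\<^sup>*"
  shows "connected_graph G"
  unfolding connected_graph_def
proof (intro conjI ballI)
  show "verts G \<noteq> {}" using assms(1) by auto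
  fix u v assume "u \<in> verts G" "v \<in> verts G"
  then show "(u, v) \<in> (adj_rel G)\<^sup>*"
    using assms(2) rtrancl_adj_rel_sym rtrancl_trans by metis
qed

text \<open>A walk from \<open>a\<close> to \<open>b\<close> has to leave \<open>S\<close> at some
  step. Every classification below rests on this: a suitable \<open>S\<close> forces a particular
  edge to be present, or shows that a vertex cannot be there.\<close>

lemma connected_graph_crossing_edge:
  assumes "connected_graph G" "a \<in> verts G" "a \<in> S" "b \<in> verts G" "b \<notin> S"
  obtains u v where "{u, v} \<in> edges G" "u \<in> S" "v \<notin> S"
proof -
  have "(a, b) \<in> (adj_rel G)\<^sup>*"
    using assms by (simp add: connected_graph_def)
  then have "\<exists>u v. {u, v} \<in> edges G \<and> u \<in> S \<and> v \<notin> S"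
    using assms(3,5)
  proof (induction rule: rtrancl_induct)
    case base
    then show ?case by simp
  next
    case (step y z)
    then show ?case by (cases "y \<in> S") (auto simp: adj_rel_iff)
  qed
  then show ?thesis using that by blast
qed

lemma mem_connected_subgraphs:
  "(V, E) \<in> connected_subgraphs G \<longleftrightarrow>
     V \<subseteq> verts G \<and> E \<subseteq> edges G \<and> (\<forall>e\<in>E. e \<subseteq> V) \<and> connected_graph (V, E)"
  by (auto simp: connected_subgraphs_def connected_graph_def)

lemma finite_connected_subgraphs:
  assumes "finite_simple_graph G"
  shows "finite (connected_subgraphs G)"
proof -
  have "edges G \<subseteq> Pow (verts G)" and V: "finite (verts G)"
    using assms by (auto simp: finite_simple_graph_def)
  then have "finite (edges G)"
    by (meson finite_Pow_iff finite_subset)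
  moreover have "connected_subgraphs G \<subseteq> Pow (verts G) \<times> Pow (edges G)"
    by (auto simp: connected_subgraphs_def)
  ultimately show ?thesis
    using V by (meson finite_Pow_iff finite_SigmaI finite_subset)
qed

section \<open>Invariance under isomorphism\<close>

lemma graph_iso_sym:
  assumes "graph_iso G H"
  shows "graph_iso H G"
proof -
  obtain f where f: "bij_betw f (verts G) (verts H)"
    and e: "\<And>u v. u \<in> verts G \<Longrightarrow> v \<in> verts G \<Longrightarrow> {u, v} \<in> edges G \<longleftrightarrow> {f u, f v} \<in> edges H"
    using assms by (auto simp: graph_iso_def)
  let ?h = "inv_into (verts G) f"
  have "bij_betw ?h (verts H) (verts G)"
    using f by (rule bij_betw_inv_into)
  moreover have "{u, v} \<in> edges H \<longleftrightarrow> {?h u, ?h v} \<in> edges G"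
    if "u \<in> verts H" "v \<in> verts H" for u v
  proof -
    have "?h u \<in> verts G" "?h v \<in> verts G"
      using that \<open>bij_betw ?h (verts H) (verts G)\<close> by (auto dest: bij_betwE)
    moreover have "f (?h u) = u" "f (?h v) = v"
      using that f by (simp_all add: bij_betw_inv_into_right)
    ultimately show ?thesis
      using e[of "?h u" "?h v"] by simp
  qed
  ultimately show ?thesis
    unfolding graph_iso_def by blast
qed

text \<open>An isomorphism \<open>f\<close> acts on subgraphs by taking images of vertices and
  edges, which preserves connectedness and is injective. The inequality is enough, since the inverse
  isomorphism gives the opposite one.\<close>

lemma core_index_mono_iso:
  assumes G: "finite_simple_graph G" and H: "finite_simple_graph H" and "graph_iso G H"
  shows "core_index G \<le> core_index H"
proof -
  obtain f where f: "bij_betw f (verts G) (verts H)"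
    and e: "\<And>u v. u \<in> verts G \<Longrightarrow> v \<in> verts G \<Longrightarrow> {u, v} \<in> edges G \<longleftrightarrow> {f u, f v} \<in> edges H"
    using assms by (auto simp: graph_iso_def)
  define \<phi> where "\<phi> = (\<lambda>(V, E). (f ` V, (`) f ` E))"
  have inj: "inj_on f (verts G)" and im: "f ` verts G = verts H"
    using f by (auto simp: bij_betw_def)
  have GE: "edges G \<subseteq> Pow (verts G)"
    using G by (auto simp: finite_simple_graph_def)
  \<comment> \<open>Injectivity is lifted twice: once to sets of vertices, then to sets of edges,
    which are sets of sets of vertices.\<close>
  have inj1: "inj_on ((`) f) (Pow (verts G))"
    using inj by (rule inj_on_image_Pow)
  then have inj2: "inj_on ((`) ((`) f)) (Pow (Pow (verts G)))"
    by (rule inj_on_image_Pow)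
  have "inj_on \<phi> (connected_subgraphs G)"
  proof (rule inj_onI)
    fix A B assume A: "A \<in> connected_subgraphs G" and B: "B \<in> connected_subgraphs G"
      and eq: "\<phi> A = \<phi> B"
    have "fst A = fst B"
      using A B eq by (intro inj_onD[OF inj1])
        (auto simp: connected_subgraphs_def \<phi>_def case_prod_beta)
    moreover have "snd A = snd B"
      using A B eq GE
      by (intro inj_onD[OF inj2]) (auto simp: connected_subgraphs_def \<phi>_def case_prod_beta)
    ultimately show "A = B"
      by (simp add: prod_eq_iff)
  qed
  moreover have "\<phi> ` connected_subgraphs G \<subseteq> connected_subgraphs H"
  proof (rule image_subsetI)
    fix K assume K: "K \<in> connected_subgraphs G"
    obtain V E where VE: "K = (V, E)" by (cases K)
    have V: "V \<subseteq> verts G" and E: "E \<subseteq> edges G" and EV: "\<And>e. e \<in> E \<Longrightarrow> e \<subseteq> V"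
      and con: "connected_graph (V, E)"
      using K by (auto simp: VE mem_connected_subgraphs)
    \<comment> \<open>\<open>graph_iso\<close> speaks of pairs of vertices only, so an edge has to
      be written as \<open>{u, v}\<close> before it can be transported.\<close>
    have "f ` d \<in> edges H" if "d \<in> E" for d
    proof -
      have "card d = 2" "d \<subseteq> verts G" "d \<in> edges G"
        using that E G by (auto simp: finite_simple_graph_def)
      then obtain u v where "d = {u, v}" by (auto simp: card_2_iff)
      then show ?thesis
        using e[of u v] \<open>d \<subseteq> verts G\<close> \<open>d \<in> edges G\<close> by auto
    qed
    moreover have "f ` V \<subseteq> verts H"
      using V im by auto
    moreover have "connected_graph (f ` V, (`) f ` E)"
    proof -
      have step: "(f u, f v) \<in> (adj_rel (f ` V, (`) f ` E))\<^sup>*"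
        if "(u, v) \<in> (adj_rel (V, E))\<^sup>*" for u v
        using that
      proof (induction rule: rtrancl_induct)
        case base
        then show ?case by simp
      next
        case (step y z)
        have "{f y, f z} = f ` {y, z}" by simp
        then have "(f y, f z) \<in> adj_rel (f ` V, (`) f ` E)"
          using step.hyps(2) by (simp add: adj_rel_iff del: image_insert)
        then show ?case
          using step.IH by (meson rtrancl.rtrancl_into_rtrancl)
      qed
      show ?thesis
        using con step by (auto simp: connected_graph_def)
    qed
    moreover have "\<forall>e\<in>E. f ` e \<subseteq> f ` V"
      using EV by (meson image_mono)
    ultimately show "\<phi> K \<in> connected_subgraphs H"
      by (auto simp: VE \<phi>_def mem_connected_subgraphs)
  qed
  ultimately show ?thesis
    unfolding core_index_def using finite_connected_subgraphs[OF H] by (metis card_inj_on_le)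
qed

lemma core_index_iso:
  assumes "finite_simple_graph G" "finite_simple_graph H" "graph_iso G H"
  shows "core_index G = core_index H"
  using assms by (meson core_index_mono_iso graph_iso_sym le_antisym)

section \<open>Pendant vertices\<close>

definition connected_subgraphs_at :: "'a graph \<Rightarrow> 'a \<Rightarrow> 'a graph set" where
  "connected_subgraphs_at G x = {H \<in> connected_subgraphs G. x \<in> verts H}"

text \<open>This operation serves two purposes: it enlarges the host graph, and it extends a
  subgraph through \<open>x\<close> by the new edge.\<close>

definition add_pendant :: "'a \<Rightarrow> 'a \<Rightarrow> 'a graph \<Rightarrow> 'a graph" where
  "add_pendant x w G = (insert w (verts G), insert {x, w} (edges G))"

lemma finite_simple_graph_add_pendant:
  assumes "finite_simple_graph G" "x \<in> verts G" "w \<notin> verts G"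
  shows "finite_simple_graph (add_pendant x w G)"
proof -
  have "x \<noteq> w" using assms by auto
  then show ?thesis
    using assms by (auto simp: finite_simple_graph_def add_pendant_def)
qed

lemma connected_graph_add_pendant:
  assumes "connected_graph H" "x \<in> verts H"
  shows "connected_graph (add_pendant x w H)"
proof (rule connected_graph_rootI[of x])
  show "x \<in> verts (add_pendant x w H)"
    using assms by (simp add: add_pendant_def)
  fix v assume v: "v \<in> verts (add_pendant x w H)"
  have sub: "adj_rel H \<subseteq> adj_rel (add_pendant x w H)"
    by (auto simp: adj_rel_def add_pendant_def)
  show "(x, v) \<in> (adj_rel (add_pendant x w H))\<^sup>*"
  proof (cases "v = w")
    case True
    then show ?thesis by (auto simp: adj_rel_def add_pendant_def)
  next
    case False
    then have "(x, v) \<in> (adj_rel H)\<^sup>*"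
      using v assms by (auto simp: add_pendant_def connected_graph_def)
    then show ?thesis
      using rtrancl_mono[OF sub] by blast
  qed
qed

lemma connected_graph_remove_pendant:
  assumes con: "connected_graph (V, E)" and x: "x \<in> V" "x \<noteq> w"
    and leaf: "\<And>e. e \<in> E \<Longrightarrow> w \<in> e \<Longrightarrow> e = {x, w}"
  shows "connected_graph (V - {w}, E - {{x, w}})"
proof (rule connected_graph_rootI[of x])
  show "x \<in> verts (V - {w}, E - {{x, w}})"
    using x by simp
  fix v assume v: "v \<in> verts (V - {w}, E - {{x, w}})"
  then have "(x, v) \<in> (adj_rel (V, E))\<^sup>*"
    using con x by (simp add: connected_graph_def)
  \<comment> \<open>The first alternative covers the moments when the walk stands at
    \<open>w\<close>; the next step leads back to \<open>x\<close>, which reaches itself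
    trivially.\<close>
  then have "v = w \<or> (x, v) \<in> (adj_rel (V - {w}, E - {{x, w}}))\<^sup>*"
  proof (induction rule: rtrancl_induct)
    case base
    then show ?case by simp
  next
    case (step y z)
    have yz: "{y, z} \<in> E"
      using step.hyps by (simp add: adj_rel_iff)
    consider "z = w" | "z \<noteq> w" "y = w" | "z \<noteq> w" "y \<noteq> w" by blast
    then show ?case
    proof cases
      case 1
      then show ?thesis by simp
    next
      case 2
      then have "z = x"
        using leaf[OF yz] by (auto simp: doubleton_eq_iff)
      then show ?thesis by simp
    next
      case 3
      then have "{y, z} \<noteq> {x, w}" by (auto simp: doubleton_eq_iff)
      then have "(y, z) \<in> adj_rel (V - {w}, E - {{x, w}})"
        using yz by (simp add: adj_rel_iff)
      then show ?thesis
        using step.IH 3 by (meson rtrancl.rtrancl_into_rtrancl)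
    qed
  qed
  then show "(x, v) \<in> (adj_rel (V - {w}, E - {{x, w}}))\<^sup>*"
    using v by simp
qed

text \<open>A connected subgraph either avoids \<open>w\<close>, or uses the edge
  \<open>{x, w}\<close> and stays connected after losing it together with \<open>w\<close>, or
  contains \<open>w\<close> without that edge. In the last case no edge leaves \<open>w\<close>, so
  the subgraph is the single vertex \<open>w\<close>.\<close>

lemma connected_subgraphs_add_pendant:
  assumes G: "finite_simple_graph G" and x: "x \<in> verts G" and w: "w \<notin> verts G"
  shows "connected_subgraphs (add_pendant x w G) =
    connected_subgraphs G \<union> {({w}, {})} \<union> add_pendant x w ` connected_subgraphs_at G x"
    (is "?L = ?R")
proof
  have GE: "e \<subseteq> verts G" "card e = 2" if "e \<in> edges G" for e
    using G that by (auto simp: finite_simple_graph_def)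
  have xw: "x \<noteq> w" using x w by auto
  show "?L \<subseteq> ?R"
  proof (rule subsetI, rule ccontr)
    fix H assume HL: "H \<in> ?L" and HR: "H \<notin> ?R"
    obtain V E where H: "H = (V, E)" by (cases H)
    have VE: "(V, E) \<in> ?L" and notG: "(V, E) \<notin> connected_subgraphs G"
      and notim: "(V, E) \<notin> add_pendant x w ` connected_subgraphs_at G x"
      and notw: "(V, E) \<noteq> ({w}, {})"
      using HL HR H by auto
    have V: "V \<subseteq> insert w (verts G)" and E: "E \<subseteq> insert {x, w} (edges G)"
      and EV: "\<And>e. e \<in> E \<Longrightarrow> e \<subseteq> V" and con: "connected_graph (V, E)"
      using VE by (auto simp: mem_connected_subgraphs add_pendant_def)
    have leaf: "e = {x, w}" if "e \<in> E" "w \<in> e" for e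
      using that E GE w by auto
    have "w \<notin> V"
    proof
      assume wV: "w \<in> V"
      show False
      proof (cases "{x, w} \<in> E")
        case True
        then have xV: "x \<in> V" using EV by blast
        have "(V - {w}, E - {{x, w}}) \<in> connected_subgraphs_at G x"
        proof -
          have "e \<subseteq> V - {w}" if "e \<in> E - {{x, w}}" for e
            using that EV leaf by blast
          moreover have "V - {w} \<subseteq> verts G" "E - {{x, w}} \<subseteq> edges G"
            using V E by auto
          ultimately show ?thesis
            using xV xw connected_graph_remove_pendant[OF con xV xw leaf]
            by (simp add: connected_subgraphs_at_def mem_connected_subgraphs)
        qed
        moreover have "(V, E) = add_pendant x w (V - {w}, E - {{x, w}})"
          using True wV by (auto simp: add_pendant_def)
        ultimately show False using notim by blast
      next
        case False
        have "V = {w}"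
        proof (rule ccontr)
          assume "V \<noteq> {w}"
          then obtain b where "b \<in> V" "b \<noteq> w" using wV by blast
          then obtain u v where "{u, v} \<in> E" "u \<in> {w}"
            using connected_graph_crossing_edge[OF con, of w "{w}" b] wV
            by (metis fst_conv insertI1 singletonD snd_conv)
          then show False using leaf[of "{u, v}"] False by auto
        qed
        moreover have "E = {}"
        proof (rule ccontr)
          assume "E \<noteq> {}"
          then obtain e where e: "e \<in> E" by blast
          then have "e \<in> edges G" using False E by auto
          then have "e \<subseteq> {}" "card e = 2"
            using GE[of e] EV[OF e] \<open>V = {w}\<close> w by auto
          then show False by simp
        qed
        ultimately show False using notw by simp
      qed
    qed
    then show False
      using V E EV con notG by (auto simp: mem_connected_subgraphs)
  qed
  have "add_pendant x w (V, E) \<in> ?L" if "(V, E) \<in> connected_subgraphs_at G x" for V E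
  proof -
    have VE: "(V, E) \<in> connected_subgraphs G" "x \<in> V"
      using that by (auto simp: connected_subgraphs_at_def)
    then have "connected_graph (add_pendant x w (V, E))"
      by (intro connected_graph_add_pendant) (auto simp: mem_connected_subgraphs)
    then show ?thesis
      using VE by (auto simp: mem_connected_subgraphs add_pendant_def)
  qed
  then have "add_pendant x w ` connected_subgraphs_at G x \<subseteq> ?L" by auto
  moreover have "connected_subgraphs G \<subseteq> ?L"
    by (auto simp: connected_subgraphs_def add_pendant_def)
  moreover have "({w}, {}) \<in> ?L"
    by (auto simp: connected_subgraphs_def connected_graph_def add_pendant_def)
  ultimately show "?R \<subseteq> ?L" by blast
qed

text \<open>The three families of the preceding decomposition are disjoint: old subgraphs lack
  \<open>w\<close>, and extended ones have an edge, unlike the single vertex. Since old subgraphs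
  contain neither \<open>w\<close> nor \<open>{x, w}\<close>, extension is injective. Through
  \<open>x\<close> run exactly the old subgraphs through \<open>x\<close> and their extensions,
  hence the factor 2.\<close>

lemma card_connected_subgraphs_add_pendant:
  assumes G: "finite_simple_graph G" and x: "x \<in> verts G" and w: "w \<notin> verts G"
  shows "card (connected_subgraphs (add_pendant x w G)) =
      card (connected_subgraphs G) + card (connected_subgraphs_at G x) + 1"
    and "card (connected_subgraphs_at (add_pendant x w G) x) =
      2 * card (connected_subgraphs_at G x)"
proof -
  let ?A = "connected_subgraphs_at G x"
  have nw: "w \<notin> verts H" "{x, w} \<notin> edges H" if "H \<in> connected_subgraphs G" for H
  proof -
    show "w \<notin> verts H" using that w by (auto simp: connected_subgraphs_def)
    then show "{x, w} \<notin> edges H"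
      using that unfolding connected_subgraphs_def by blast
  qed
  have fin: "finite (connected_subgraphs G)" "finite ?A"
    using finite_connected_subgraphs[OF G] by (auto simp: connected_subgraphs_at_def)
  have "inj_on (add_pendant x w) ?A"
  proof (rule inj_onI)
    fix H K assume "H \<in> ?A" "K \<in> ?A" "add_pendant x w H = add_pendant x w K"
    moreover from this have "H \<in> connected_subgraphs G" "K \<in> connected_subgraphs G"
      by (auto simp: connected_subgraphs_at_def)
    note nw[OF this(1)] nw[OF this(2)]
    ultimately show "H = K"
      by (auto simp: add_pendant_def prod_eq_iff insert_ident)
  qed
  then have card_im: "card (add_pendant x w ` ?A) = card ?A"
    by (rule card_image)
  have d1: "({w}, {}) \<notin> connected_subgraphs G"
    using nw by fastforce
  have d2: "({w}, {}) \<notin> add_pendant x w ` ?A"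
    by (auto simp: add_pendant_def)
  have d3: "connected_subgraphs G \<inter> add_pendant x w ` ?A = {}"
    using nw by (fastforce simp: add_pendant_def)
  have L: "connected_subgraphs (add_pendant x w G) =
      insert ({w}, {}) (connected_subgraphs G \<union> add_pendant x w ` ?A)"
    using connected_subgraphs_add_pendant[OF assms] by simp
  show "card (connected_subgraphs (add_pendant x w G)) =
      card (connected_subgraphs G) + card ?A + 1"
    unfolding L using fin d1 d2 d3 card_im by (simp add: card_Un_disjoint)
  have "connected_subgraphs_at (add_pendant x w G) x = ?A \<union> add_pendant x w ` ?A"
    unfolding connected_subgraphs_at_def[of "add_pendant x w G"] L using x w
    by (auto simp: connected_subgraphs_at_def add_pendant_def)
  moreover have "?A \<inter> add_pendant x w ` ?A = {}"
    using d3 by (auto simp: connected_subgraphs_at_def)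
  ultimately show "card (connected_subgraphs_at (add_pendant x w G) x) = 2 * card ?A"
    using fin card_im by (simp add: card_Un_disjoint)
qed

section \<open>Cycles\<close>

text \<open>Indexing the edges by their lower endpoint turns statements about edge sets into
  statements about sets of numbers.\<close>

definition path_edges :: "nat set \<Rightarrow> nat set set" where
  "path_edges K = (\<lambda>k. {k, Suc k}) ` K"

text \<open>The upper end comes first, so that the admissible pairs form a \<open>Sigma\<close> set
  over \<open>j\<close> and their number is a sum over \<open>j\<close>.\<close>

definition arc :: "nat \<times> nat \<Rightarrow> nat graph" where
  "arc = (\<lambda>(j, i). ({i..j}, path_edges {i..<j}))"

text \<open>The arcs of \<open>C\<^sub>g\<close> through the closing edge \<open>{g - 1, 0}\<close>, from \<open>j\<close> up to \<open>g - 1\<close> and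
  on from \<open>0\<close> up to \<open>i\<close>.\<close>

definition closing_arc :: "nat \<Rightarrow> nat \<times> nat \<Rightarrow> nat graph" where
  "closing_arc g = (\<lambda>(j, i). ({..i} \<union> {j..<g},
     insert {0, g - 1} (path_edges ({..<i} \<union> {j..<g - 1}))))"

lemma cycle_graph_alt:
  assumes "3 \<le> g"
  shows "cycle_graph g = ({..<g}, insert {0, g - 1} (path_edges {..<g - 1}))"
proof -
  have "{..<g} = insert (g - 1) {..<g - 1}"
    using assms by auto
  then have "{{i, (i + 1) mod g} | i. i < g} =
      (\<lambda>i. {i, (i + 1) mod g}) ` insert (g - 1) {..<g - 1}"
    by (metis (no_types) lessThan_def setcompr_eq_image)
  also have "\<dots> = insert {g - 1, 0} ((\<lambda>i. {i, (i + 1) mod g}) ` {..<g - 1})"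
    using assms by simp
  also have "(\<lambda>i. {i, (i + 1) mod g}) ` {..<g - 1} = path_edges {..<g - 1}"
    unfolding path_edges_def by (rule image_cong) auto
  finally show ?thesis
    by (simp add: cycle_graph_def insert_commute atLeast0LessThan)
qed

lemma path_edge_eq_iff: "{k, Suc k} = {l, Suc l} \<longleftrightarrow> k = l"
  by (auto simp: doubleton_eq_iff)

lemma path_edge_mem_iff: "{k, Suc k} \<in> path_edges K \<longleftrightarrow> k \<in> K"
  by (auto simp: path_edges_def path_edge_eq_iff)

text \<open>For \<open>g = 2\<close> the closing edge would be \<open>{0, 1}\<close>, itself a path
  edge; from \<open>g = 3\<close> on it is distinguishable from all of them. This is what separates
  the two kinds of arcs.\<close>

lemma path_edge_neq_closing: "3 \<le> g \<Longrightarrow> {k, Suc k} \<noteq> {0, g - 1}"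
  by (auto simp: doubleton_eq_iff)

lemma closing_notin_path_edges:
  assumes "3 \<le> g"
  shows "{0, g - 1} \<notin> path_edges K"
proof
  assume "{0, g - 1} \<in> path_edges K"
  then obtain k where "{0, g - 1} = {k, Suc k}"
    unfolding path_edges_def by (rule imageE)
  then show False using path_edge_neq_closing[OF assms, of k] by simp
qed

lemma path_reachable:
  assumes "a \<le> b" "\<And>k. a \<le> k \<Longrightarrow> k < b \<Longrightarrow> {k, Suc k} \<in> edges G"
  shows "(a, b) \<in> (adj_rel G)\<^sup>*"
  using assms
proof (induction b rule: dec_induct)
  case base
  then show ?case by simp
next
  case (step m)
  then have "(m, Suc m) \<in> adj_rel G" by (simp add: adj_rel_iff)
  then show ?case using step by (meson less_SucI rtrancl.rtrancl_into_rtrancl)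
qed

section \<open>Connectedness of arcs, closing arcs and cycles\<close>

lemma connected_graph_arc:
  assumes "i \<le> j"
  shows "connected_graph (arc (j, i))"
  using assms
  by (intro connected_graph_rootI[of i] path_reachable) (auto simp: arc_def path_edge_mem_iff)

lemma connected_graph_closing_arc:
  assumes "j < g"
  shows "connected_graph (closing_arc g (j, i))"
proof (rule connected_graph_rootI[of 0])
  let ?G = "closing_arc g (j, i)"
  show "0 \<in> verts ?G" by (simp add: closing_arc_def)
  fix v assume "v \<in> verts ?G"
  then consider "v \<le> i" | "j \<le> v" "v < g"
    by (auto simp: closing_arc_def)
  then show "(0, v) \<in> (adj_rel ?G)\<^sup>*"
  proof cases
    case 1
    then show ?thesis
      by (intro path_reachable) (auto simp: closing_arc_def path_edge_mem_iff)
  next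
    case 2
    \<comment> \<open>A vertex of the upper piece climbs to \<open>g - 1\<close>; the closing edge
      and the reversed climb then lead to it from 0.\<close>
    then have "(v, g - 1) \<in> (adj_rel ?G)\<^sup>*"
      by (intro path_reachable) (auto simp: closing_arc_def path_edge_mem_iff)
    moreover have "(0, g - 1) \<in> adj_rel ?G"
      by (simp add: adj_rel_iff closing_arc_def)
    ultimately show ?thesis
      by (meson converse_rtrancl_into_rtrancl rtrancl_adj_rel_sym)
  qed
qed

lemma connected_graph_cycle:
  assumes "3 \<le> g"
  shows "connected_graph (cycle_graph g)"
  using assms
  by (intro connected_graph_rootI[of 0] path_reachable)
    (auto simp: cycle_graph_alt path_edge_mem_iff)

section \<open>Classification of the connected subgraphs of a cycle\<close>

lemma connected_path_subgraph_is_arc: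
  assumes con: "connected_graph (V, E)" and fin: "finite V"
    and E: "E \<subseteq> range (\<lambda>k. {k, Suc k})" and EV: "\<And>e. e \<in> E \<Longrightarrow> e \<subseteq> V"
  shows "(V, E) = arc (Max V, Min V)"
proof -
  have ne: "V \<noteq> {}" using con by (simp add: connected_graph_def)
  have mem: "Min V \<in> V" "Max V \<in> V" using fin ne by auto
  have all: "{k, Suc k} \<in> E" if k: "Min V \<le> k" "k < Max V" for k
  proof -
    \<comment> \<open>The cut between \<open>k\<close> and \<open>Suc k\<close> separates
      \<open>Min V\<close> from \<open>Max V\<close>, and \<open>{k, Suc k}\<close> is the only path
      edge across it.\<close>
    obtain u v where uv: "{u, v} \<in> E" "u \<in> {..k}" "v \<notin> {..k}"
      using connected_graph_crossing_edge[OF con, of "Min V" "{..k}" "Max V"] mem k by auto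
    then obtain l where "{u, v} = {l, Suc l}" using E by auto
    then have "{u, v} = {k, Suc k}"
      using uv by (auto simp: doubleton_eq_iff)
    then show ?thesis using uv by simp
  qed
  have V: "V = {Min V..Max V}"
  proof
    show "V \<subseteq> {Min V..Max V}" using fin by auto
    show "{Min V..Max V} \<subseteq> V"
    proof
      fix k assume k: "k \<in> {Min V..Max V}"
      show "k \<in> V"
      proof (cases "k = Max V")
        case False
        then have "{k, Suc k} \<in> E" using k all by auto
        then show ?thesis using EV by blast
      qed (use mem in simp)
    qed
  qed
  have "E \<subseteq> path_edges {Min V..<Max V}"
  proof
    fix e assume e: "e \<in> E"
    then obtain k where k: "e = {k, Suc k}" using E by auto
    then have "k \<in> V" "Suc k \<in> V" using EV[OF e] by auto
    then have "Min V \<le> k" "Suc k \<le> Max V" using fin by auto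
    then show "e \<in> path_edges {Min V..<Max V}"
      using k by (simp add: path_edge_mem_iff)
  qed
  then have "E = path_edges {Min V..<Max V}"
    using all by (auto simp: path_edges_def)
  then show ?thesis using V by (simp add: arc_def)
qed

text \<open>The missing path edges determine the arc: it ends at the lower endpoint \<open>i\<close>
  of the first one and resumes at the upper endpoint \<open>j\<close> of the last one. Whatever lies
  strictly between is cut off from vertex 0.\<close>

lemma connected_cycle_subgraph_is_closing_arc:
  assumes g: "3 \<le> g" and con: "connected_graph (V, E)" and V: "V \<subseteq> {..<g}"
    and E: "E \<subseteq> insert {0, g - 1} (path_edges {..<g - 1})" and EV: "\<And>e. e \<in> E \<Longrightarrow> e \<subseteq> V"
    and cl: "{0, g - 1} \<in> E" and miss: "\<exists>k<g - 1. {k, Suc k} \<notin> E"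
  shows "\<exists>j i. i < j \<and> j < g \<and> (V, E) = closing_arc g (j, i)"
proof -
  define M where "M = {k. k < g - 1 \<and> {k, Suc k} \<notin> E}"
  have fin: "finite M" and ne: "M \<noteq> {}"
    using miss by (auto simp: M_def)
  define i where "i = Min M"
  define j where "j = Suc (Max M)"
  have iM: "i \<in> M" and jM: "Max M \<in> M"
    using fin ne by (auto simp: i_def)
  have low: "{k, Suc k} \<in> E" if "k < i" for k
  proof (rule ccontr)
    assume "{k, Suc k} \<notin> E"
    then have "k \<in> M" using that iM by (auto simp: M_def)
    then have "i \<le> k" using fin by (simp add: i_def)
    then show False using that by simp
  qed
  have high: "{k, Suc k} \<in> E" if "j \<le> k" "k < g - 1" for k
  proof (rule ccontr)
    assume "{k, Suc k} \<notin> E"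
    then have "k \<in> M" using that by (auto simp: M_def)
    then have "k \<le> Max M" using fin by simp
    then show False using that by (simp add: j_def)
  qed
  have ij: "i < j" using fin iM by (simp add: j_def less_Suc_eq_le)
  have jg: "j < g" using jM by (auto simp: M_def j_def)
  have ends: "0 \<in> V" "g - 1 \<in> V" using EV[OF cl] by auto
  have Vlow: "k \<in> V" if k: "k \<le> i" for k
  proof (cases k)
    case 0
    then show ?thesis using ends by simp
  next
    case (Suc l)
    then have "{l, Suc l} \<in> E" using low k by auto
    then show ?thesis using EV Suc by blast
  qed
  have Vhigh: "k \<in> V" if "j \<le> k" "k < g" for k
  proof (cases "k = g - 1")
    case True
    then show ?thesis using ends by simp
  next
    case False
    then have "{k, Suc k} \<in> E" using high that by auto
    then show ?thesis using EV by blast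
  qed
  \<comment> \<open>The closing edge does not touch the open interval, so an edge leaving it would
    be \<open>{i, Suc i}\<close> or \<open>{Max M, Suc (Max M)}\<close>. Both are missing by the
    choice of \<open>i\<close> and \<open>j\<close>.\<close>
  have gap: "b \<notin> V" if b: "i < b" "b < j" for b
  proof
    assume "b \<in> V"
    then obtain u v where uv: "{u, v} \<in> E" "u \<in> {i<..<j}" "v \<notin> {i<..<j}"
      using connected_graph_crossing_edge[OF con, of b "{i<..<j}" 0] ends b by auto
    have "{u, v} \<noteq> {0, g - 1}"
      using uv jg by (auto simp: doubleton_eq_iff)
    then have "{u, v} \<in> path_edges {..<g - 1}"
      using uv(1) E by (meson insertE subsetD)
    then obtain l where l: "{u, v} = {l, Suc l}"
      unfolding path_edges_def by (rule imageE)
    then consider "u = l" "v = Suc l" | "u = Suc l" "v = l"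
      by (auto simp: doubleton_eq_iff)
    then have "l = i \<or> l = Max M"
      using uv(2,3) by cases (auto simp: j_def)
    then have "{l, Suc l} \<notin> E" using iM jM by (auto simp: M_def)
    then show False using uv l by simp
  qed
  have Veq: "V = {..i} \<union> {j..<g}"
  proof (rule set_eqI)
    fix k
    show "k \<in> V \<longleftrightarrow> k \<in> {..i} \<union> {j..<g}"
      using V Vlow[of k] Vhigh[of k] gap[of k] ij by (cases "k \<le> i"; cases "j \<le> k") auto
  qed
  have "E \<subseteq> insert {0, g - 1} (path_edges ({..<i} \<union> {j..<g - 1}))"
  proof
    fix e assume e: "e \<in> E"
    show "e \<in> insert {0, g - 1} (path_edges ({..<i} \<union> {j..<g - 1}))"
    proof (cases "e = {0, g - 1}")
      case False
      then have "e \<in> path_edges {..<g - 1}"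
        using e E by (meson insertE subsetD)
      then obtain k where k: "e = {k, Suc k}" "k < g - 1"
        by (auto simp: path_edges_def)
      then have "k \<in> V" "Suc k \<in> V" using EV[OF e] by auto
      \<comment> \<open>The vertex set alone does not exclude \<open>k = i\<close>: when
        \<open>j = Suc i\<close>, both ends of that edge lie in \<open>V\<close>.\<close>
      moreover have "k \<noteq> i" using k e iM by (auto simp: M_def)
      ultimately have "k \<in> {..<i} \<union> {j..<g - 1}"
        using k Veq by auto
      then show ?thesis using k by (simp add: path_edge_mem_iff)
    qed simp
  qed
  moreover have "path_edges ({..<i} \<union> {j..<g - 1}) \<subseteq> E"
    using low high by (auto simp: path_edges_def)
  ultimately have "E = insert {0, g - 1} (path_edges ({..<i} \<union> {j..<g - 1}))"
    using cl by blast
  then show ?thesis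
    using Veq ij jg by (auto simp: closing_arc_def)
qed

text \<open>Without the closing edge a subgraph lives on the path from 0 to \<open>g - 1\<close> and
  is an arc. With it, the subgraph is a closing arc if some path edge is missing, and the whole
  cycle otherwise.\<close>

lemma connected_subgraphs_cycle:
  assumes g: "3 \<le> g"
  shows "connected_subgraphs (cycle_graph g) = insert (cycle_graph g)
    (arc ` (SIGMA j:{..<g}. {..<Suc j}) \<union> closing_arc g ` (SIGMA j:{..<g}. {..<j}))"
    (is "?L = insert _ (arc ` ?I \<union> closing_arc g ` ?J)")
proof
  show "?L \<subseteq> insert (cycle_graph g) (arc ` ?I \<union> closing_arc g ` ?J)"
  proof
    fix H assume H: "H \<in> ?L"
    obtain V E where VE: "H = (V, E)" by (cases H)
    have V: "V \<subseteq> {..<g}" and E: "E \<subseteq> insert {0, g - 1} (path_edges {..<g - 1})"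
      and EV: "\<And>e. e \<in> E \<Longrightarrow> e \<subseteq> V" and con: "connected_graph (V, E)"
      using H g by (auto simp: VE mem_connected_subgraphs cycle_graph_alt)
    have fin: "finite V" using V finite_subset by blast
    have ne: "V \<noteq> {}" using con by (simp add: connected_graph_def)
    consider "{0, g - 1} \<notin> E" | "{0, g - 1} \<in> E" "\<exists>k<g - 1. {k, Suc k} \<notin> E"
      | "{0, g - 1} \<in> E" "\<forall>k<g - 1. {k, Suc k} \<in> E" by blast
    then show "H \<in> insert (cycle_graph g) (arc ` ?I \<union> closing_arc g ` ?J)"
    proof cases
      case 1
      then have "E \<subseteq> range (\<lambda>k. {k, Suc k})"
        using E by (auto simp: path_edges_def)
      then have "(V, E) = arc (Max V, Min V)"
        using connected_path_subgraph_is_arc[OF con fin _ EV] by blast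
      moreover have "Max V \<in> V" "Min V \<le> Max V" using fin ne by auto
      ultimately show ?thesis using V VE by auto
    next
      case 2
      then show ?thesis
        using connected_cycle_subgraph_is_closing_arc[OF g con V E EV] VE by auto
    next
      case 3
      then have Eeq: "E = insert {0, g - 1} (path_edges {..<g - 1})"
        using E by (auto simp: path_edges_def)
      have "k \<in> V" if "k < g" for k
      proof (cases "k = g - 1")
        case True
        then show ?thesis using EV[OF 3(1)] by simp
      next
        case False
        then have "{k, Suc k} \<in> E" using 3 that by auto
        then show ?thesis using EV by blast
      qed
      then have "V = {..<g}" using V by auto
      then show ?thesis using VE Eeq g by (simp add: cycle_graph_alt)
    qed
  qed
  have "arc (j, i) \<in> ?L" if "i \<le> j" "j < g" for i j
    using connected_graph_arc[OF that(1)] that g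
    by (auto simp: arc_def mem_connected_subgraphs cycle_graph_alt path_edges_def)
  moreover have "closing_arc g (j, i) \<in> ?L" if "i < j" "j < g" for i j
    using connected_graph_closing_arc[OF that(2), of i] that g
    by (auto simp: closing_arc_def mem_connected_subgraphs cycle_graph_alt path_edges_def)
  moreover have "cycle_graph g \<in> ?L"
    using connected_graph_cycle[OF g] g
    by (auto simp: mem_connected_subgraphs cycle_graph_alt path_edges_def)
  ultimately show "insert (cycle_graph g) (arc ` ?I \<union> closing_arc g ` ?J) \<subseteq> ?L"
    by (auto simp: less_Suc_eq_le)
qed

section \<open>Counting the connected subgraphs of a cycle\<close>

lemma inj_on_arc: "inj_on arc (SIGMA j:A. {..<Suc j})"
  by (rule inj_onI) (auto simp: arc_def less_Suc_eq_le)

text \<open>The vertex set does not suffice to recover the indices, since it is all of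
  \<open>{..<g}\<close> whenever \<open>j = Suc i\<close>. The missing path edges do: their indices
  form the nonempty interval \<open>{i..<j}\<close>.\<close>

lemma inj_on_closing_arc:
  assumes g: "3 \<le> g"
  shows "inj_on (closing_arc g) (SIGMA j:{..<g}. {..<j})"
proof (rule inj_onI, clarify)
  fix j i j' i' assume ij: "i < j" "j < g" "i' < j'" "j' < g"
    and eq: "closing_arc g (j, i) = closing_arc g (j', i')"
  have gap: "{k. k < g - 1 \<and> {k, Suc k} \<notin> edges (closing_arc g (j, i))} = {i..<j}"
    if "i < j" "j < g" for i j
    using that path_edge_neq_closing[OF g] by (auto simp: closing_arc_def path_edge_mem_iff)
  have "{i..<j} = {i'..<j'}"
    using gap[OF ij(1,2)] gap[OF ij(3,4)] eq by simp
  then show "j = j' \<and> i = i'"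
    using atLeastLessThan_inj[of i j i' j'] ij by simp
qed

text \<open>Two consecutive triangular numbers add up to a square. This is used for the cycle count
  with \<open>k = g\<close> and for the lower bound with \<open>k = n - 2\<close>.\<close>

lemma choose_two_add_choose_two_Suc: "(Suc k choose 2) + (k choose 2) = k^2"
  by (induction k) (auto simp: numeral_2_eq_2)

lemma card_connected_subgraphs_cycle:
  assumes g: "3 \<le> g"
  shows "card (connected_subgraphs (cycle_graph g)) = g^2 + 1"
    and "card (connected_subgraphs_at (cycle_graph g) 0) = (Suc g choose 2) + 1"
proof -
  let ?I = "SIGMA j:{..<g}. {..<Suc j}" and ?J = "SIGMA j:{..<g}. {..<j}"
  \<comment> \<open>These pairs index the \<open>g\<close> arcs that contain vertex 0, namely those
    starting there. All closing arcs and the cycle itself contain 0 as well.\<close>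
  let ?Z = "(\<lambda>j. (j, 0)) ` {..<g}"
  have sum1: "(\<Sum>j<g. j) = g choose 2" for g :: nat
    by (induction g) (auto simp: numeral_2_eq_2)
  have sum2: "(\<Sum>j<g. Suc j) = (Suc g choose 2)"
    using sum1[of "Suc g"] by (simp add: sum.lessThan_Suc_shift del: sum.lessThan_Suc)
  have cl_arc: "{0, g - 1} \<notin> edges (arc p)" for p
    using closing_notin_path_edges[OF g] by (auto simp: arc_def split: prod.split)
  have cl_closing: "{0, g - 1} \<in> edges (closing_arc g p)" for p
    by (auto simp: closing_arc_def split: prod.split)
  \<comment> \<open>The closing edge tells the families apart. The index set \<open>K\<close> is
    left open because both \<open>?I\<close> and \<open>?Z\<close> are substituted for it.\<close>
  have d1: "arc ` K \<inter> closing_arc g ` ?J = {}" for K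
  proof (rule ccontr)
    assume "arc ` K \<inter> closing_arc g ` ?J \<noteq> {}"
    then obtain p q where "arc p = closing_arc g q" by blast
    then show False using cl_arc[of p] cl_closing[of q] by simp
  qed
  have d2: "cycle_graph g \<notin> arc ` K" for K
  proof
    assume "cycle_graph g \<in> arc ` K"
    then obtain p where "cycle_graph g = arc p" by blast
    then show False
      using cl_arc[of p] by (simp add: cycle_graph_alt[OF g] flip: \<open>cycle_graph g = arc p\<close>)
  qed
  have d3: "cycle_graph g \<notin> closing_arc g ` ?J"
  proof clarify
    fix j i assume ij: "i < j" "j < g" and eq: "cycle_graph g = closing_arc g (j, i)"
    have "i < g - 1" using ij by simp
    then have "{i, Suc i} \<in> edges (cycle_graph g)"
      using g by (simp add: cycle_graph_alt path_edge_mem_iff)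
    then show False
      unfolding eq using ij path_edge_neq_closing[OF g] by (simp add: closing_arc_def path_edge_mem_iff)
  qed
  have c: "card (arc ` ?I) = (Suc g choose 2)" "card (closing_arc g ` ?J) = g choose 2"
    using card_image[OF inj_on_arc] card_image[OF inj_on_closing_arc[OF g]] sum1 sum2
    by (simp_all del: sum.lessThan_Suc)
  have "card (connected_subgraphs (cycle_graph g)) = 1 + ((Suc g choose 2) + (g choose 2))"
    unfolding connected_subgraphs_cycle[OF g]
    using d1[of ?I] d2[of ?I] d3 c by (simp add: card_Un_disjoint)
  also have "(Suc g choose 2) + (g choose 2) = g^2"
    by (rule choose_two_add_choose_two_Suc)
  finally show "card (connected_subgraphs (cycle_graph g)) = g^2 + 1" by simp
  have "?Z \<subseteq> ?I" by auto
  then have "card (arc ` ?Z) = g"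
    using card_image[OF inj_on_subset[OF inj_on_arc]] by (simp add: card_image inj_on_def)
  moreover have "connected_subgraphs_at (cycle_graph g) 0 =
      insert (cycle_graph g) (arc ` ?Z \<union> closing_arc g ` ?J)"
    unfolding connected_subgraphs_at_def connected_subgraphs_cycle[OF g]
    using g by (auto simp: arc_def closing_arc_def cycle_graph_alt)
  ultimately show "card (connected_subgraphs_at (cycle_graph g) 0) = (Suc g choose 2) + 1"
    using d1[of ?Z] d2[of ?Z] d3 c(2) by (simp add: card_Un_disjoint numeral_2_eq_2)
qed

section \<open>Pineapple graphs\<close>

text \<open>The value \<open>n = g\<close> gives no pineapple graph, but it starts the induction on
  the number of pendant vertices.\<close>

lemma pineapple_self: "pineapple g g = cycle_graph g"
  by (simp add: pineapple_def)

lemma pineapple_Suc: "g \<le> n \<Longrightarrow> pineapple (Suc n) g = add_pendant 0 n (pineapple n g)"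
  by (auto simp: pineapple_def add_pendant_def less_Suc_eq)

lemma finite_simple_graph_cycle: "3 \<le> g \<Longrightarrow> finite_simple_graph (cycle_graph g)"
  by (auto simp: finite_simple_graph_def cycle_graph_alt path_edges_def)

text \<open>The recursion for the total involves the count through 0 and applies to finite simple
  graphs, so the three claims are proved together. In the total, the first summand counts the
  subgraphs through 0, \<open>g choose 2\<close> those of the cycle that avoid 0, and
  \<open>m\<close> the single pendant vertices.\<close>

lemma card_connected_subgraphs_pineapple:
  assumes "3 \<le> g"
  shows "card (connected_subgraphs (pineapple (g + m) g)) =
      2 ^ m * ((Suc g choose 2) + 1) + (g choose 2) + m
    \<and> card (connected_subgraphs_at (pineapple (g + m) g) 0) = 2 ^ m * ((Suc g choose 2) + 1)
    \<and> finite_simple_graph (pineapple (g + m) g)"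
proof (induction m)
  case 0
  have "g^2 = (Suc g choose 2) + (g choose 2)"
    by (rule choose_two_add_choose_two_Suc[symmetric])
  then show ?case
    using card_connected_subgraphs_cycle[OF assms] finite_simple_graph_cycle[OF assms]
    by (simp add: pineapple_self)
next
  case (Suc m)
  let ?P = "pineapple (g + m) g"
  have eq: "pineapple (g + Suc m) g = add_pendant 0 (g + m) ?P"
    by (simp add: pineapple_Suc)
  have "0 \<in> verts ?P" "g + m \<notin> verts ?P"
    using assms by (auto simp: pineapple_def cycle_graph_def)
  then show ?case
    unfolding eq using Suc card_connected_subgraphs_add_pendant[of ?P 0 "g + m"]
    by (simp add: finite_simple_graph_add_pendant)
qed

lemma core_index_pineapple:
  assumes "3 \<le> g" "g < n"
  shows "core_index (pineapple n g) =
    2 ^ (n - g) * ((Suc g choose 2) + 1) + (g choose 2) + (n - g)"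
  using conjunct1[OF card_connected_subgraphs_pineapple[OF assms(1), of "n - g"]] assms(2)
  by (simp add: core_index_def)

section \<open>Strict monotonicity in the cycle length\<close>

lemma core_index_pineapple_Suc_less:
  assumes "3 \<le> g" "Suc g < n"
  shows "core_index (pineapple n (Suc g)) < core_index (pineapple n g)"
proof -
  \<comment> \<open>The longer cycle leaves \<open>m + 1\<close> pendant vertices and the shorter
    one \<open>m + 2\<close>. With \<open>c\<close> and \<open>p\<close> as below, the two core
    indices differ by \<open>2 * p * c - g + 1\<close>, so \<open>g \<le> p * c\<close>
    suffices.\<close>
  obtain m where n: "n = Suc (Suc g) + m"
    using Suc_leI[OF assms(2)] by (rule le_Suc_ex[THEN exE])
  define c where "c = g choose 2"
  define p :: nat where "p = 2 ^ m"
  have s: "(Suc g choose 2) = c + g" "Suc (Suc g) choose 2 = c + 2 * g + 1"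
    by (simp_all add: c_def numeral_2_eq_2)
  \<comment> \<open>Equality holds at \<open>h = 3\<close>, and the right side grows by
    \<open>h\<close> at each step.\<close>
  have "h \<le> h choose 2" if "3 \<le> h" for h :: nat
    using that by (induction h rule: dec_induct) (auto simp: numeral_2_eq_2 numeral_3_eq_3)
  then have "g \<le> c" using assms(1) by (simp add: c_def)
  moreover have "1 \<le> p" by (simp add: p_def)
  ultimately have "g \<le> p * c"
    using mult_le_mono[of 1 p g c] by simp
  moreover have "core_index (pineapple n (Suc g)) = 2 * p * (c + 2 * g + 2) + (c + g) + (m + 1)"
    using assms core_index_pineapple[of "Suc g" n] s by (simp add: n p_def)
  moreover have "core_index (pineapple n g) = 4 * p * (c + g + 1) + c + (m + 2)"
    using assms core_index_pineapple[of g n] s by (simp add: n p_def c_def)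
  ultimately show ?thesis by (simp add: algebra_simps)
qed

lemma core_index_pineapple_less:
  assumes "3 \<le> g" "g < h" "h < n"
  shows "core_index (pineapple n h) < core_index (pineapple n g)"
  using assms(2,3)
proof (induction h)
  case (Suc h)
  then show ?case
    using core_index_pineapple_Suc_less[of h n] assms(1) by (cases "g = h") auto
qed simp

section \<open>The bounds and their equality cases\<close>

theorem theorem4p5:
  fixes n :: nat and G :: "'a graph"
  assumes "n \<ge> 4"
    and "finite_simple_graph G"
    and "\<exists>g. 3 \<le> g \<and> g < n \<and> graph_iso G (pineapple n g)"
  shows "n^2 + 1 + ((n - 2) choose 2) \<le> core_index G
    \<and> core_index G \<le> 7 * 2 ^ (n - 3) + n
    \<and> (core_index G = 7 * 2 ^ (n - 3) + n \<longleftrightarrow> graph_iso G (pineapple n 3))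
    \<and> (core_index G = n^2 + 1 + ((n - 2) choose 2) \<longleftrightarrow> graph_iso G (pineapple n (n - 1)))"
proof -
  obtain g where g: "3 \<le> g" "g < n" and iso: "graph_iso G (pineapple n g)"
    using assms(3) by blast
  \<comment> \<open>This is stated for every \<open>h\<close>, not just the given \<open>g\<close>,
    because the equality cases also assume an isomorphism with \<open>h = 3\<close> or
    \<open>h = n - 1\<close>.\<close>
  have F: "core_index G = core_index (pineapple n h)"
    if "3 \<le> h" "h < n" "graph_iso G (pineapple n h)" for h
    using that assms(2) by (intro core_index_iso finite_simple_graph_pineapple) auto
  have top: "core_index (pineapple n 3) = 7 * 2 ^ (n - 3) + n"
  proof -
    have "Suc 3 choose 2 = 6" "3 choose 2 = (3::nat)"
      by (simp_all add: numeral_2_eq_2 numeral_3_eq_3)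
    then show ?thesis
      using core_index_pineapple[of 3 n] assms(1) by simp
  qed
  have bot: "core_index (pineapple n (n - 1)) = n^2 + 1 + ((n - 2) choose 2)"
  proof -
    \<comment> \<open>With \<open>c = k choose 2\<close>, both sides become
      \<open>3 * c + 5 * k + 5\<close> once \<open>k^2\<close> is replaced by
      \<open>2 * c + k\<close>.\<close>
    obtain k where n: "n = Suc (Suc k)"
      using le_Suc_ex[of 2 n] assms(1) by auto
    have "k^2 = (Suc k choose 2) + (k choose 2)"
      by (rule choose_two_add_choose_two_Suc[symmetric])
    then show ?thesis
      using core_index_pineapple[of "n - 1" n] assms(1)
      by (simp add: n numeral_2_eq_2)
  qed
  have upper: "core_index (pineapple n g) < core_index (pineapple n 3)" if "g \<noteq> 3"
    using core_index_pineapple_less[of 3 g n] g that by simp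
  have lower: "core_index (pineapple n (n - 1)) < core_index (pineapple n g)" if "g \<noteq> n - 1"
    using core_index_pineapple_less[of g "n - 1" n] g that by simp
  \<comment> \<open>By strictness, attaining a bound forces \<open>g = 3\<close> or
    \<open>g = n - 1\<close>, and then \<open>iso\<close> is already the isomorphism
    required.\<close>
  show ?thesis
    using F[OF g iso] F[of 3] F[of "n - 1"] upper lower iso assms(1)
    unfolding top[symmetric] bot[symmetric] by fastforce
qed

end
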